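(* Let the iterative algorithm given by $A:\mathbb{R}^{Nd}\times\mathcal{X}\to\mathcal{X}$ and $C=(C_1,\ldots,C_N):\mathcal{X}\to\mathbb{R}^{Nd}$ be $\sigma$-linear convergent in the norm $\|\cdot\|$ with $\sigma\in(0,1)$, point $\mathbf{x}^\star$ and constants $L_A>0$, $L_C\ge 0$ (as defined in the context). Let $b\ge 1$ be an integer and consider the $b$-bit quantized algorithm described in the context, started at $\mathbf{x}^0\in\mathcal{X}$. Let $D>0$ be such that either (i) $\|\mathbf{x}^1-\mathbf{x}^0\|\le(1-\sigma)D$, or (ii) $\|\mathbf{x}^0-\mathbf{x}^\star\|\le D$; the parameter $\sigma$, the initialization $\mathbf{q}_i^0$ ($i=1,\ldots,N$) and the bound $D$ are available before running the algorithm. Set $$r^k=\frac{K}{L_A}\,\alpha(b)^{k+1}D,\qquad \alpha(b)=\frac{K}{2^b-1}+\sigma,\qquad K=\max\left\{1,\frac{2L_AL_C}{\sigma}\right\},$$ and assume $\alpha(b)<1$. Let $\theta\ge0$ be the number of overhead bits, $n=bd+\theta$, let $R(n)>0$ be the transmission rate, $\Delta(n)=n/R(n)$, and let $\mathbf{x}(t)=\mathbf{x}^k$ for $t\in[k\Delta(n),(k+1)\Delta(n))$, $k\in\mathbb{N}$. Then we have the following convergence in terms of the transmission time $t\ge 0$: $$\|\mathbf{x}(t)-\mathbf{x}^\star\|\le\left(\left[\frac{K}{2^b-1}+\sigma\right]^{R(n)/n}\right)^{t-\Delta(n)}D.$$ Moreover, for any $\epsilon>0$, $$\|\mathbf{x}(t)-\mathbf{x}^\star\|\le\epsilon\quad\text{for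 all } t\ge T_\epsilon(b,\theta),$$ where $$T_\epsilon(b,\theta):=k_\epsilon(b)\,\Delta(bd+\theta)\ \text{seconds},\qquad k_\epsilon(b):=\frac{1}{1-\alpha(b)}\log\left(\frac{D}{\epsilon}\right).$$
   Context: $\mathbb{N}=\{0,1,2,\ldots\}$; $\log$ is the natural logarithm; $N,d\ge1$ are integers; $\|\cdot\|_\infty$ is the max-norm. $\mathcal{X}$ is a subset of a finite-dimensional Euclidean space and $\|\cdot\|$ is a norm (on the linear span of $\mathcal{X}$). Unquantized algorithm: $\mathbf{x}^{k+1}=A(\mathbf{c}^k,\mathbf{x}^k)$, $\mathbf{c}_i^{k+1}=C_i(\mathbf{x}^{k+1})$ for $i=1,\ldots,N$, where $\mathbf{c}^k=(\mathbf{c}^k_1,\ldots,\mathbf{c}^k_N)$, $A:\mathbb{R}^{Nd}\times\mathcal{X}\to\mathcal{X}$, $C_i:\mathcal{X}\to\mathbb{R}^d$, and $C(\mathbf{x})=(C_1(\mathbf{x}),\ldots,C_N(\mathbf{x}))$. $\sigma$-linear convergent in the norm $\|\cdot\|$: (a) there is $\mathbf{x}^\star\in\mathcal{X}$ with $\|A(C(\mathbf{x}),\mathbf{x})-\mathbf{x}^\star\|\le\sigma\|\mathbf{x}-\mathbf{x}^\star\|$ for all $\mathbf{x}\in\mathcal{X}$; (b) there are constants $L_A,L_C$ such that $\|A(\mathbf{c}_1,\mathbf{x})-A(\mathbf{c}_2,\mathbf{x})\|\le L_A\|\mathbf{c}_1-\mathbf{c}_2\|_\infty$ and $\|C(\mathbf{x}_1)-C(\mathbf{x}_2)\|_\infty\le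 L_C\|\mathbf{x}_1-\mathbf{x}_2\|$ for all $\mathbf{x},\mathbf{x}_1,\mathbf{x}_2\in\mathcal{X}$, $\mathbf{c}_1,\mathbf{c}_2\in\mathbb{R}^{Nd}$. Quantization function $\mathrm{quant}:\mathbb{R}^d\times\mathbb{R}^d\times\mathbb{R}_+\times\mathbb{N}\to\mathbb{R}^d$, defined componentwise with $\delta=r/(2^b-1)$ (first applicable case): $$[\mathrm{quant}(\mathbf{c},\mathbf{q},r,b)]_j=\begin{cases}\mathbf{q}_j-r&\text{if }\mathbf{c}_j\le\mathbf{q}_j-r+\delta,\\ \mathbf{q}_j+r&\text{if }\mathbf{c}_j\ge\mathbf{q}_j+r-\delta,\\ \mathbf{q}_j-r+2\delta\left\lfloor\frac{\mathbf{c}_j-\mathbf{q}_j+r+\delta}{2\delta}\right\rfloor&\text{otherwise.}\end{cases}$$ $b$-bit quantized algorithm: given $\mathbf{x}^0\in\mathcal{X}$, set $\mathbf{q}_i^0=\mathbf{c}_i^0=C_i(\mathbf{x}^0)$, and for $k\in\mathbb{N}$, with $\mathbf{q}^k=(\mathbf{q}^k_1,\ldots,\mathbf{q}^k_N)$, $$\mathbf{x}^{k+1}=A(\mathbf{q}^k,\mathbf{x}^k),\quad \mathbf{c}_i^{k+1}=C_i(\mathbf{x}^{k+1}),\quad \mathbf{q}_i^{k+1}=\mathrm{quant}(\mathbf{c}_i^{k+1},\mathbf{q}_i^k,r^k,b),\quad i=1,\ldots,N.$$ Transmission-time model (error-free communication): per iteration each node communicates a package of $n=bd+\theta$ bits ($b$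 per dimension plus $\theta$ overhead bits); $R(n)$ is the transmission rate in bits per second; one iteration takes $\Delta(n)=n/R(n)$ seconds and $k$ iterations take $k\Delta(n)$ seconds.
   Formalization: The bound ‖x(t)−x*‖≤ε is stated for all t≥0 with t≥⌈k_ε(b)⌉Δ(n), i.e. T_ε rounded up to a whole number of iterations, since for non-integer k_ε the claim for all t≥T_ε can fail (e.g. k_ε=1/2, where x(T_ε)=x^0). *)

theory Defs
  imports "HOL-Analysis.Analysis"
begin

definition norm_on :: "'a::real_vector set \<Rightarrow> ('a \<Rightarrow> real) \<Rightarrow> bool" where
  "norm_on S \<nu> \<longleftrightarrow>
     (\<forall>x\<in>S. 0 \<le> \<nu> x \<and> (\<nu> x = 0 \<longleftrightarrow> x = 0)) \<and>
     (\<forall>x\<in>S. \<forall>a. \<nu> (a *\<^sub>R x) = \<bar>a\<bar> * \<nu> x) \<and>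
     (\<forall>x\<in>S. \<forall>y\<in>S. \<nu> (x + y) \<le> \<nu> x + \<nu> y)"

text \<open>The stacked space of dimension \<open>N * d\<close> is \<open>real^'d^'n\<close>, with \<open>c $ i\<close> the block of node \<open>i\<close>.
  On it \<^const>\<open>infnorm\<close> is the maximum of the absolute values of all \<open>N * d\<close> coordinates.\<close>

definition stack :: "('n \<Rightarrow> 'a \<Rightarrow> real^'d) \<Rightarrow> 'a \<Rightarrow> real^'d^'n::finite" where
  "stack C x = (\<chi> i. C i x)"

definition linear_convergent ::
  "('a::euclidean_space \<Rightarrow> real) \<Rightarrow> 'a set \<Rightarrow> (real^'d^'n \<Rightarrow> 'a \<Rightarrow> 'a) \<Rightarrow> ('n::finite \<Rightarrow> 'a \<Rightarrow> real^'d::finite)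
    \<Rightarrow> real \<Rightarrow> 'a \<Rightarrow> real \<Rightarrow> real \<Rightarrow> bool" where
  "linear_convergent \<nu> X A C \<sigma> xs LA LC \<longleftrightarrow>
     xs \<in> X \<and>
     (\<forall>x\<in>X. \<nu> (A (stack C x) x - xs) \<le> \<sigma> * \<nu> (x - xs)) \<and>
     (\<forall>x\<in>X. \<forall>c1 c2. \<nu> (A c1 x - A c2 x) \<le> LA * infnorm (c1 - c2)) \<and>
     (\<forall>x1\<in>X. \<forall>x2\<in>X. infnorm (stack C x1 - stack C x2) \<le> LC * \<nu> (x1 - x2))"

definition quant :: "real^'d \<Rightarrow> real^'d \<Rightarrow> real \<Rightarrow> nat \<Rightarrow> real^'d::finite" where
  "quant c q r b = (let \<delta> = r / (2 ^ b - 1) in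
     \<chi> j. if c $ j \<le> q $ j - r + \<delta> then q $ j - r
          else if c $ j \<ge> q $ j + r - \<delta> then q $ j + r
          else q $ j - r + 2 * \<delta> * of_int \<lfloor>(c $ j - q $ j + r + \<delta>) / (2 * \<delta>)\<rfloor>)"

primrec quantized_run ::
  "(real^'d^'n \<Rightarrow> 'a \<Rightarrow> 'a) \<Rightarrow> ('n \<Rightarrow> 'a \<Rightarrow> real^'d) \<Rightarrow> (nat \<Rightarrow> real) \<Rightarrow> nat \<Rightarrow> 'a
    \<Rightarrow> nat \<Rightarrow> 'a \<times> (real^'d::finite^'n::finite)" where
  "quantized_run A C r b x0 0 = (x0, stack C x0)"
| "quantized_run A C r b x0 (Suc k) =
     (let (x, q) = quantized_run A C r b x0 k; x' = A q x
      in (x', \<chi> i. quant (C i x') (q $ i) (r k) b))"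

definition quantized_iter ::
  "(real^'d::finite^'n::finite \<Rightarrow> 'a \<Rightarrow> 'a) \<Rightarrow> ('n \<Rightarrow> 'a \<Rightarrow> real^'d) \<Rightarrow> (nat \<Rightarrow> real) \<Rightarrow> nat \<Rightarrow> 'a
    \<Rightarrow> nat \<Rightarrow> 'a" where
  "quantized_iter A C r b x0 k = fst (quantized_run A C r b x0 k)"

definition K_const :: "real \<Rightarrow> real \<Rightarrow> real \<Rightarrow> real" where
  "K_const \<sigma> LA LC = max 1 (2 * LA * LC / \<sigma>)"

definition \<alpha>_rate :: "real \<Rightarrow> real \<Rightarrow> real \<Rightarrow> nat \<Rightarrow> real" where
  "\<alpha>_rate \<sigma> LA LC b = K_const \<sigma> LA LC / (2 ^ b - 1) + \<sigma>"

definition \<Delta>_time :: "(nat \<Rightarrow> real) \<Rightarrow> nat \<Rightarrow> real" where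
  "\<Delta>_time R n = real n / R n"

definition k_eps :: "real \<Rightarrow> real \<Rightarrow> real \<Rightarrow> real \<Rightarrow> real \<Rightarrow> nat \<Rightarrow> real" where
  "k_eps \<sigma> LA LC D \<epsilon> b = 1 / (1 - \<alpha>_rate \<sigma> LA LC b) * ln (D / \<epsilon>)"

text \<open>\<open>k_eps\<close> is real-valued, hence \<open>T_eps\<close> need not be a multiple of the duration \<open>\<Delta>_time\<close> of an
  iteration: a statement about the piecewise constant iterate at time \<open>t\<close> has to round it up to one.\<close>

definition T_eps ::
  "(nat \<Rightarrow> real) \<Rightarrow> nat \<Rightarrow> real \<Rightarrow> real \<Rightarrow> real \<Rightarrow> real \<Rightarrow> real \<Rightarrow> nat \<Rightarrow> nat \<Rightarrow> real" where
  "T_eps R d \<sigma> LA LC D \<epsilon> b \<theta> = k_eps \<sigma> LA LC D \<epsilon> b * \<Delta>_time R (b * d + \<theta>)"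

end

theory Submission
  imports Defs
begin

text \<open>
  The quantizer with range \<open>r\<close> centred at \<open>q\<close> has resolution \<open>r / (2 ^ b - 1)\<close>: as long as its
  input lies within distance \<open>r\<close> of \<open>q\<close> in every coordinate, its output is that close to
  the input (\<open>quant_error\<close>). The ranges \<open>r k\<close> shrink geometrically, so the point is that the input
  never leaves the shrinking range. Write \<open>\<alpha> = K / (2 ^ b - 1) + \<sigma>\<close>. Two bounds sustain each other
  along the run (\<open>quantized_run_invariant\<close>):

  \<^item> the iterate satisfies \<open>\<nu> (x - xs) \<le> \<alpha> ^ k * D\<close>;
  \<^item> the quantization error satisfies \<open>LA * infnorm (q - stack C x) \<le> (\<alpha> - \<sigma>) * \<alpha> ^ k * D\<close>.

  The exact step contracts by \<open>\<sigma>\<close> and the quantization error enters with the factor \<open>LA\<close>, so one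
  iteration turns the two bounds into \<open>\<sigma> + (\<alpha> - \<sigma>) = \<alpha>\<close> times the first. The next message then
  differs from the current quantized value by at most the change of \<open>stack C\<close>, controlled
  through \<open>LC\<close> by the two successive distances to \<open>xs\<close>, plus the current quantization error. The
  constant \<open>K\<close> is large enough for that total to fit into \<open>r k\<close>
  (\<open>quantizer_range_sufficient\<close>), and \<open>r k / (2 ^ b - 1)\<close> is the next error bound.
  The initial bound \<open>\<nu> (x0 - xs) \<le> D\<close> can be replaced by a bound on the first step, because that
  step is exact and a \<open>\<sigma>\<close>-contraction moves a point by at least \<open>1 - \<sigma>\<close> times its distance to the
  fixed point.

  At time \<open>t\<close> the number of completed iterations is \<open>\<lfloor>t / \<Delta>\<rfloor> > t / \<Delta> - 1\<close>, which gives the bound in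
  terms of time. For the accuracy \<open>\<epsilon>\<close>, the inequality \<open>\<alpha> \<le> exp (\<alpha> - 1)\<close> turns
  \<open>\<alpha> ^ k * D \<le> \<epsilon>\<close> into a linear condition on \<open>k\<close>.
\<close>

section \<open>The maximum norm and the quantizer\<close>

text \<open>The canonical basis vectors of the stacked space pick out single coordinates of single blocks.\<close>

lemma infnorm_stacked_le_iff:
  fixes v :: "real^'d::finite^'n::finite"
  shows "infnorm v \<le> e \<longleftrightarrow> (\<forall>i j. \<bar>v $ i $ j\<bar> \<le> e)"
proof -
  have "infnorm v \<le> e \<longleftrightarrow> (\<forall>u\<in>Basis. \<bar>v \<bullet> u\<bar> \<le> e)"
    by (simp add: infnorm_Max)
  also have "\<dots> \<longleftrightarrow> (\<forall>i j. \<bar>v $ i $ j\<bar> \<le> e)"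
    by (auto simp: Basis_vec_def inner_axis)
  finally show ?thesis .
qed

text \<open>Within its range the quantizer rounds to the midpoint of a cell of width \<open>2 * \<delta>\<close>. The two clipped
  cases only concern inputs that lie within \<open>\<delta>\<close> of an end point of the range.\<close>

lemma quant_error:
  assumes "0 < r" "1 \<le> b" and range: "\<bar>c $ j - q $ j\<bar> \<le> r"
  shows "\<bar>quant c q r b $ j - c $ j\<bar> \<le> r / (2 ^ b - 1)"
proof -
  define \<delta> where "\<delta> = r / (2 ^ b - 1)"
  define u where "u = (c $ j - q $ j + r + \<delta>) / (2 * \<delta>)"
  have "(2::real) ^ 1 \<le> 2 ^ b"
    using assms(2) by (intro power_increasing) auto
  then have \<delta>: "\<delta> > 0"
    using assms(1) by (simp add: \<delta>_def)
  have u: "2 * \<delta> * u = c $ j - q $ j + r + \<delta>"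
    using \<delta> by (simp add: u_def)
  have "2 * \<delta> * of_int \<lfloor>u\<rfloor> \<le> 2 * \<delta> * u" "2 * \<delta> * u \<le> 2 * \<delta> * (of_int \<lfloor>u\<rfloor> + 1)"
    using \<delta> by (intro mult_left_mono; linarith)+
  then have "2 * \<delta> * of_int \<lfloor>u\<rfloor> \<le> c $ j - q $ j + r + \<delta>"
            "c $ j - q $ j + r + \<delta> \<le> 2 * \<delta> * of_int \<lfloor>u\<rfloor> + 2 * \<delta>"
    unfolding u by (simp_all add: algebra_simps)
  moreover have "quant c q r b $ j = (if c $ j \<le> q $ j - r + \<delta> then q $ j - r
      else if c $ j \<ge> q $ j + r - \<delta> then q $ j + r else q $ j - r + 2 * \<delta> * of_int \<lfloor>u\<rfloor>)"
    by (simp add: quant_def Let_def \<delta>_def u_def)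
  ultimately show ?thesis
    using range \<delta> unfolding \<delta>_def[symmetric] by (auto simp: abs_le_iff)
qed

lemma infnorm_quant_error:
  fixes c q :: "real^'d::finite^'n::finite"
  assumes "0 < r" "1 \<le> b" and "infnorm (c - q) \<le> r"
  shows "infnorm ((\<chi> i. quant (c $ i) (q $ i) r b) - c) \<le> r / (2 ^ b - 1)"
  using assms by (auto simp: infnorm_stacked_le_iff intro!: quant_error)

section \<open>Geometric convergence of the quantized iteration\<close>

lemma norm_on_span_triangle:
  assumes "norm_on (span X) \<nu>" "x \<in> X" "y \<in> X" "z \<in> X"
  shows "\<nu> (x - z) \<le> \<nu> (x - y) + \<nu> (y - z)"
proof -
  have "x - y \<in> span X" "y - z \<in> span X"
    using assms by (auto intro: span_diff span_base)
  then have "\<nu> ((x - y) + (y - z)) \<le> \<nu> (x - y) + \<nu> (y - z)"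
    using assms(1) unfolding norm_on_def by blast
  then show ?thesis by simp
qed

lemma norm_on_span_commute:
  assumes "norm_on (span X) \<nu>" "x \<in> X" "y \<in> X"
  shows "\<nu> (x - y) = \<nu> (y - x)"
proof -
  have "x - y \<in> span X"
    using assms by (auto intro: span_diff span_base)
  then have "\<nu> ((-1) *\<^sub>R (x - y)) = \<bar>-1\<bar> * \<nu> (x - y)"
    using assms(1) unfolding norm_on_def by blast
  then show ?thesis by simp
qed

text \<open>The left-hand side bounds \<open>LA\<close> times the distance between the next message and the current
  quantized value, in units of \<open>\<alpha> ^ k * D\<close>: two successive distances to the limit, amplified by
  \<open>LC\<close>, and the present quantization error. The right-hand side is \<open>LA\<close> times the range in the same
  units. Since \<open>\<alpha> + 1 \<le> 2\<close>, and \<open>2 * LA * LC \<le> K * \<sigma>\<close> by the choice of \<open>K\<close>, what remains is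
  \<open>(K - 1) * (\<alpha> - \<sigma>) \<ge> 0\<close>.\<close>

lemma quantizer_range_sufficient:
  assumes "0 < \<sigma>" "0 < LA" "0 \<le> LC" "\<sigma> \<le> \<alpha>" "\<alpha> \<le> 1"
  shows "LA * LC * (\<alpha> + 1) + (\<alpha> - \<sigma>) \<le> K_const \<sigma> LA LC * \<alpha>"
proof -
  define K where "K = K_const \<sigma> LA LC"
  have K1: "1 \<le> K" and "2 * LA * LC / \<sigma> \<le> K"
    by (auto simp: K_def K_const_def)
  then have K2: "2 * (LA * LC) \<le> K * \<sigma>"
    using assms(1) by (simp add: pos_divide_le_eq)
  have "LA * LC * (\<alpha> + 1) \<le> LA * LC * 2"
    using assms by (intro mult_left_mono) auto
  moreover have "0 \<le> (K - 1) * (\<alpha> - \<sigma>)"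
    using K1 assms by simp
  ultimately show ?thesis
    using K2 by (simp add: K_def algebra_simps)
qed

lemma first_step_bound:
  assumes norm: "norm_on (span X) \<nu>" and X: "x0 \<in> X" "x1 \<in> X" "xs \<in> X"
    and contr: "\<nu> (x1 - xs) \<le> \<sigma> * \<nu> (x0 - xs)" and "\<sigma> < 1"
    and step: "\<nu> (x1 - x0) \<le> (1 - \<sigma>) * D"
  shows "\<nu> (x0 - xs) \<le> D"
proof -
  have "\<nu> (x0 - xs) \<le> \<nu> (x1 - x0) + \<nu> (x1 - xs)"
    using norm_on_span_triangle[OF norm X] norm_on_span_commute[OF norm X(1,2)] by simp
  then have "(1 - \<sigma>) * \<nu> (x0 - xs) \<le> (1 - \<sigma>) * D"
    using contr step by (simp add: algebra_simps)
  then show ?thesis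
    using \<open>\<sigma> < 1\<close> by simp
qed

text \<open>Both bounds have to be carried through the induction together: the error bound at stage \<open>k\<close>
  is needed for the next iterate, and the bounds on both iterates show that the next message
  stays within the range of the quantizer. At \<open>k = 0\<close> the messages are sent exactly.\<close>

lemma quantized_run_invariant:
  fixes X :: "'a::euclidean_space set"
    and A :: "real^'d::finite^'n::finite \<Rightarrow> 'a \<Rightarrow> 'a"
    and \<sigma> LA LC D :: real
    and b :: nat
  defines "\<alpha> \<equiv> \<alpha>_rate \<sigma> LA LC b"
  assumes norm: "norm_on (span X) \<nu>"
    and A_maps: "\<And>c y. y \<in> X \<Longrightarrow> A c y \<in> X"
    and conv: "linear_convergent \<nu> X A C \<sigma> xs LA LC"
    and pos: "0 < \<sigma>" "0 < LA" "0 \<le> LC" "1 \<le> b" "0 < D"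
    and r: "\<And>k. r k = K_const \<sigma> LA LC / LA * \<alpha> ^ (k + 1) * D"
    and x0: "x0 \<in> X" "\<nu> (x0 - xs) \<le> D"
    and alpha: "\<alpha> \<le> 1"
    and run: "quantized_run A C r b x0 k = (x, q)"
  shows "x \<in> X" (is ?in)
    and "\<nu> (x - xs) \<le> \<alpha> ^ k * D" (is ?iterate)
    and "LA * infnorm (q - stack C x) \<le> (\<alpha> - \<sigma>) * \<alpha> ^ k * D" (is ?error)
proof -
  define K where "K = K_const \<sigma> LA LC"
  define M :: real where "M = 2 ^ b - 1"
  have "(2::real) ^ 1 \<le> 2 ^ b"
    using pos by (intro power_increasing) auto
  then have M: "1 \<le> M" by (simp add: M_def)
  have K: "1 \<le> K" by (simp add: K_def K_const_def)
  have KM: "\<alpha> - \<sigma> = K / M"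
    by (simp add: \<alpha>_def \<alpha>_rate_def K_def M_def)
  have \<alpha>\<sigma>: "\<sigma> \<le> \<alpha>" and \<alpha>0: "0 < \<alpha>"
    using KM K M pos(1) by (smt (verit) divide_pos_pos)+
  have xs: "xs \<in> X"
    and contr: "\<And>y. y \<in> X \<Longrightarrow> \<nu> (A (stack C y) y - xs) \<le> \<sigma> * \<nu> (y - xs)"
    and lipA: "\<And>y c1 c2. y \<in> X \<Longrightarrow> \<nu> (A c1 y - A c2 y) \<le> LA * infnorm (c1 - c2)"
    and lipC: "\<And>y z. y \<in> X \<Longrightarrow> z \<in> X \<Longrightarrow> infnorm (stack C y - stack C z) \<le> LC * \<nu> (y - z)"
    using conv unfolding linear_convergent_def by blast+
  have "?in \<and> ?iterate \<and> ?error"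
    using run
  proof (induction k arbitrary: x q)
    case 0
    then show ?case
      using x0 \<alpha>\<sigma> pos by (auto simp: infnorm_0)
  next
    case (Suc k)
    obtain y p where yp: "quantized_run A C r b x0 k = (y, p)"
      by fastforce
    define E where "E = \<alpha> ^ k * D"
    have E: "0 < E" using \<alpha>0 pos by (simp add: E_def)
    have y: "y \<in> X" "\<nu> (y - xs) \<le> E" "LA * infnorm (p - stack C y) \<le> (\<alpha> - \<sigma>) * E"
      using Suc.IH[OF yp] by (auto simp: E_def mult.assoc)
    have xq: "x = A p y" "q = (\<chi> i. quant (stack C x $ i) (p $ i) (r k) b)"
      using Suc.prems yp by (auto simp: Let_def stack_def)
    have x: "x \<in> X" using A_maps y xq by auto

    \<comment> \<open>The exact step followed by its perturbation through the quantized messages.\<close>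
    have "\<nu> (x - xs) \<le> \<nu> (A p y - A (stack C y) y) + \<nu> (A (stack C y) y - xs)"
      unfolding xq(1) by (intro norm_on_span_triangle[OF norm] A_maps y xs)
    also have "\<dots> \<le> LA * infnorm (p - stack C y) + \<sigma> * \<nu> (y - xs)"
      by (intro add_mono lipA contr y)
    also have "\<dots> \<le> (\<alpha> - \<sigma>) * E + \<sigma> * E"
      using y pos by (intro add_mono mult_left_mono) auto
    finally have iterate: "\<nu> (x - xs) \<le> \<alpha> * E"
      by (simp add: algebra_simps)

    \<comment> \<open>The new message stays within the quantizer range around the previous quantized value.\<close>
    have "\<nu> (x - y) \<le> \<nu> (x - xs) + \<nu> (y - xs)"
      using norm_on_span_triangle[OF norm x xs y(1)] norm_on_span_commute[OF norm y(1) xs] by simp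
    also have "\<dots> \<le> (\<alpha> + 1) * E"
      using iterate y by (simp add: algebra_simps)
    finally have "LC * \<nu> (x - y) \<le> LC * ((\<alpha> + 1) * E)"
      using pos by (intro mult_left_mono)
    then have move: "infnorm (stack C x - stack C y) \<le> LC * ((\<alpha> + 1) * E)"
      using lipC[OF x y(1)] by linarith
    have "infnorm (stack C x - p) \<le> infnorm (stack C x - stack C y) + infnorm (p - stack C y)"
      using infnorm_triangle[of "stack C x - stack C y" "stack C y - p"]
      by (simp add: infnorm_sub)
    then have "LA * infnorm (stack C x - p)
        \<le> LA * (infnorm (stack C x - stack C y) + infnorm (p - stack C y))"
      using pos by (intro mult_left_mono) auto
    also have "\<dots> \<le> LA * (LC * ((\<alpha> + 1) * E)) + (\<alpha> - \<sigma>) * E"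
      unfolding distrib_left using y(3) move pos by (intro add_mono mult_left_mono) auto
    also have "\<dots> = (LA * LC * (\<alpha> + 1) + (\<alpha> - \<sigma>)) * E"
      by (simp add: algebra_simps)
    also have "\<dots> \<le> K * \<alpha> * E"
      unfolding K_def using quantizer_range_sufficient[OF pos(1-3) \<alpha>\<sigma> alpha] E
      by (intro mult_right_mono) auto
    finally have "infnorm (stack C x - p) \<le> K * \<alpha> * E / LA"
      using pos by (simp add: pos_le_divide_eq mult.commute)
    also have rk: "K * \<alpha> * E / LA = r k"
      by (simp add: r K_def E_def)
    finally have range: "infnorm (stack C x - p) \<le> r k" .

    have "0 < r k"
      using rk K \<alpha>0 E pos by (metis divide_pos_pos less_le_trans mult_pos_pos zero_less_one)
    then have "infnorm (q - stack C x) \<le> r k / M"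
      unfolding xq(2) M_def using pos range by (intro infnorm_quant_error) auto
    then have "LA * infnorm (q - stack C x) \<le> LA * (r k / M)"
      using pos by (intro mult_left_mono) auto
    also have "\<dots> = (\<alpha> - \<sigma>) * (\<alpha> * E)"
      using pos by (simp add: KM rk[symmetric])
    finally show ?case
      using x iterate by (simp add: E_def mult.assoc)
  qed
  then show ?in ?iterate ?error by blast+
qed

section \<open>From iterations to transmission time\<close>

lemma iteration_at_time:
  assumes "0 < \<Delta>" "0 \<le> (t::real)"
  obtains k :: nat where "real k * \<Delta> \<le> t" "t < (real k + 1) * \<Delta>"
proof
  have "of_nat (nat \<lfloor>t / \<Delta>\<rfloor>) = (of_int \<lfloor>t / \<Delta>\<rfloor> :: real)"
    using assms by simp
  then have "real (nat \<lfloor>t / \<Delta>\<rfloor>) \<le> t / \<Delta>" "t / \<Delta> < real (nat \<lfloor>t / \<Delta>\<rfloor>) + 1"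
    by linarith+
  then show "real (nat \<lfloor>t / \<Delta>\<rfloor>) * \<Delta> \<le> t" "t < (real (nat \<lfloor>t / \<Delta>\<rfloor>) + 1) * \<Delta>"
    using assms(1) by (simp_all only: pos_le_divide_eq pos_divide_less_eq)
qed

text \<open>Since the base is at most one, it is the lower bound \<open>k > t / \<Delta> - 1\<close> that matters.\<close>

lemma power_le_powr_time:
  assumes "0 < \<alpha>" "\<alpha> \<le> 1" "0 < \<Delta>" "t < (real k + 1) * \<Delta>"
  shows "\<alpha> ^ k \<le> (\<alpha> powr (1 / \<Delta>)) powr (t - \<Delta>)"
proof -
  have "1 / \<Delta> * (t - \<Delta>) \<le> real k"
    using assms by (simp add: field_simps)
  then have "\<alpha> powr real k \<le> \<alpha> powr (1 / \<Delta> * (t - \<Delta>))"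
    using assms by (intro powr_mono') auto
  then show ?thesis
    using assms by (simp add: powr_powr powr_realpow)
qed

text \<open>The exact threshold for \<open>k\<close> is \<open>ln (D / \<epsilon>) / ln (1 / \<alpha>)\<close>; the simpler denominator \<open>1 - \<alpha>\<close> comes
  from \<open>\<alpha> \<le> exp (\<alpha> - 1)\<close>, that is, \<open>1 - \<alpha> \<le> ln (1 / \<alpha>)\<close>.\<close>

lemma geometric_accuracy:
  assumes "0 < \<alpha>" "\<alpha> < 1" "0 < D" "0 < \<epsilon>"
    and k: "1 / (1 - \<alpha>) * ln (D / \<epsilon>) \<le> real k"
  shows "\<alpha> ^ k * D \<le> \<epsilon>"
proof -
  have "\<alpha> \<le> exp (\<alpha> - 1)"
    using exp_ge_add_one_self[of "\<alpha> - 1"] by simp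
  then have "\<alpha> ^ k \<le> exp (\<alpha> - 1) ^ k"
    using assms by (intro power_mono) auto
  also have "\<dots> = exp (- (real k * (1 - \<alpha>)))"
    by (simp add: exp_of_nat_mult[symmetric] algebra_simps)
  also have "\<dots> \<le> exp (- ln (D / \<epsilon>))"
    using assms by (simp add: field_simps)
  also have "\<dots> = \<epsilon> / D"
    using assms by (simp add: exp_minus)
  finally show ?thesis
    using assms by (simp add: field_simps)
qed

theorem theorem2:
  fixes X :: "'a::euclidean_space set"
    and \<nu> :: "'a \<Rightarrow> real"
    and A :: "real^'d::finite^'n::finite \<Rightarrow> 'a \<Rightarrow> 'a"
    and C :: "'n \<Rightarrow> 'a \<Rightarrow> real^'d"
    and xs x0 :: 'a
    and \<sigma> LA LC D :: real
    and r R :: "nat \<Rightarrow> real"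
    and b \<theta> n :: nat
    and x :: "nat \<Rightarrow> 'a"
    and xt :: "real \<Rightarrow> 'a"
  assumes norm: "norm_on (span X) \<nu>"
    and A_maps: "\<And>c y. y \<in> X \<Longrightarrow> A c y \<in> X"
    and conv: "linear_convergent \<nu> X A C \<sigma> xs LA LC"
    and sigma: "0 < \<sigma>" "\<sigma> < 1"
    and LA: "0 < LA" and LC: "0 \<le> LC"
    and b: "1 \<le> b"
    and r: "\<And>k. r k = K_const \<sigma> LA LC / LA * \<alpha>_rate \<sigma> LA LC b ^ (k + 1) * D"
    and x0: "x0 \<in> X"
    and x: "x = quantized_iter A C r b x0"
    and D: "0 < D"
    and init: "\<nu> (x 1 - x 0) \<le> (1 - \<sigma>) * D \<or> \<nu> (x 0 - xs) \<le> D"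
    and alpha: "\<alpha>_rate \<sigma> LA LC b < 1"
    and n: "n = b * CARD('d) + \<theta>"
    and R: "0 < R n"
    and xt: "\<And>k t. real k * \<Delta>_time R n \<le> t \<Longrightarrow> t < (real k + 1) * \<Delta>_time R n \<Longrightarrow> xt t = x k"
  shows "(\<forall>t\<ge>0. \<nu> (xt t - xs)
            \<le> ((K_const \<sigma> LA LC / (2 ^ b - 1) + \<sigma>) powr (R n / real n)) powr (t - \<Delta>_time R n) * D)
       \<and> (\<forall>\<epsilon>>0. \<forall>t\<ge>0.
            of_int \<lceil>T_eps R CARD('d) \<sigma> LA LC D \<epsilon> b \<theta> / \<Delta>_time R n\<rceil> * \<Delta>_time R n \<le> t
              \<longrightarrow> \<nu> (xt t - xs) \<le> \<epsilon>)"
proof -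
  define \<alpha> where "\<alpha> = \<alpha>_rate \<sigma> LA LC b"
  define \<Delta> where "\<Delta> = \<Delta>_time R n"
  have rate: "K_const \<sigma> LA LC / (2 ^ b - 1) + \<sigma> = \<alpha>"
    by (simp add: \<alpha>_def \<alpha>_rate_def)
  have "0 \<le> K_const \<sigma> LA LC / (2 ^ b - 1)"
    by (simp add: K_const_def)
  then have \<alpha>: "0 < \<alpha>" "\<alpha> < 1"
    using rate sigma alpha by (auto simp: \<alpha>_def)
  have "0 < n" using b n by simp
  then have \<Delta>: "0 < \<Delta>" "R n / real n = 1 / \<Delta>"
    using R by (auto simp: \<Delta>_def \<Delta>_time_def)
  have start: "x 0 = x0" "x 1 = A (stack C x0) x0"
    by (simp_all add: x quantized_iter_def Let_def)
  have xs: "xs \<in> X" "\<nu> (x 1 - xs) \<le> \<sigma> * \<nu> (x0 - xs)"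
    using conv x0 unfolding start linear_convergent_def by blast+
  have "x 1 \<in> X"
    using A_maps x0 start by simp
  then have init': "\<nu> (x0 - xs) \<le> D"
    using init first_step_bound[OF norm x0 _ xs sigma(2)] start(1) by auto
  have iterates: "\<nu> (x k - xs) \<le> \<alpha> ^ k * D" for k
  proof -
    obtain y q where yq: "quantized_run A C r b x0 k = (y, q)"
      by fastforce
    have "\<nu> (y - xs) \<le> \<alpha> ^ k * D"
      unfolding \<alpha>_def using alpha
      by (intro quantized_run_invariant(2)[OF norm A_maps conv sigma(1) LA LC b D r x0 init' _ yq]) auto
    then show ?thesis
      by (simp add: x quantized_iter_def yq)
  qed
  show ?thesis
  proof (intro conjI allI impI)
    fix t :: real assume "t \<ge> 0"
    with \<Delta>(1) obtain k :: nat where k: "real k * \<Delta> \<le> t" "t < (real k + 1) * \<Delta>"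
      by (rule iteration_at_time)
    then have "\<nu> (xt t - xs) \<le> \<alpha> ^ k * D"
      using xt iterates by (simp add: \<Delta>_def)
    also have "\<dots> \<le> (\<alpha> powr (1 / \<Delta>)) powr (t - \<Delta>) * D"
      using \<alpha> \<Delta> k D by (intro mult_right_mono power_le_powr_time) auto
    finally show "\<nu> (xt t - xs)
        \<le> ((K_const \<sigma> LA LC / (2 ^ b - 1) + \<sigma>) powr (R n / real n)) powr (t - \<Delta>_time R n) * D"
      by (simp add: rate \<Delta>(2) \<Delta>_def)
  next
    fix \<epsilon> t :: real
    assume "\<epsilon> > 0" "t \<ge> 0"
      and late: "of_int \<lceil>T_eps R CARD('d) \<sigma> LA LC D \<epsilon> b \<theta> / \<Delta>_time R n\<rceil> * \<Delta>_time R n \<le> t"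
    define k\<epsilon> where "k\<epsilon> = k_eps \<sigma> LA LC D \<epsilon> b"
    have "T_eps R CARD('d) \<sigma> LA LC D \<epsilon> b \<theta> / \<Delta>_time R n = k\<epsilon>"
      using \<Delta> by (simp add: T_eps_def n k\<epsilon>_def \<Delta>_def)
    with late have late': "of_int \<lceil>k\<epsilon>\<rceil> * \<Delta> \<le> t"
      by (simp add: \<Delta>_def)
    obtain k :: nat where k: "real k * \<Delta> \<le> t" "t < (real k + 1) * \<Delta>"
      using iteration_at_time[OF \<Delta>(1) \<open>t \<ge> 0\<close>] .
    \<comment> \<open>Both sides are integers, so the strict inequality up to \<open>k + 1\<close> leaves \<open>\<lceil>k\<epsilon>\<rceil> \<le> k\<close>.\<close>
    have "of_int \<lceil>k\<epsilon>\<rceil> < real k + 1"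
      using le_less_trans[OF late' k(2)] \<Delta>(1) by (simp only: mult_less_cancel_right_pos)
    then have "\<lceil>k\<epsilon>\<rceil> < int k + 1"
      by (simp flip: of_int_less_iff[where 'a = real])
    then have "k\<epsilon> \<le> real k"
      by (simp add: ceiling_le_iff)
    then have "\<alpha> ^ k * D \<le> \<epsilon>"
      using \<alpha> D \<open>\<epsilon> > 0\<close> by (intro geometric_accuracy) (auto simp: k\<epsilon>_def k_eps_def \<alpha>_def)
    moreover have "xt t = x k"
      using xt k by (simp add: \<Delta>_def)
    ultimately show "\<nu> (xt t - xs) \<le> \<epsilon>"
      using iterates[of k] by simp
  qed
qed

end
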